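(* Let $q$ be a power of a prime $p$ and $K$ an algebraic closure of $\mathbb{F}_q$, with $\mathrm{PGL}(3,q)$ and its subgroup $\mathrm{PSL}(3,q)$ acting on $\mathrm{PG}(2,K)$. Every $\mathrm{PSL}(3,q)$-invariant irreducible plane curve of degree smaller than $q^3-q$ is also $\mathrm{PGL}(3,q)$-invariant.
   Context: Plane curves are projective plane curves over $K$; irreducible means irreducible over $K$; a curve is $G$-invariant if every element of $G$ maps it onto itself. *)

theory Defs
  imports "HOL-Analysis.Analysis" "HOL-Computational_Algebra.Polynomial_Factorial"
begin

text \<open>Trivariate polynomials over a field K are represented as nested univariate
polynomials: type 'k poly poly poly.  The innermost variable is X, the middle one Y,
the outermost one Z.  The coefficient of X^k Y^j Z^i in F is coeff (coeff (coeff F i) j) k.\<close>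

type_synonym 'k tpoly = "'k poly poly poly"

definition const3 :: "'k::comm_ring_1 \<Rightarrow> 'k tpoly" where
  "const3 c = [:[:[:c:]:]:]"

definition varX :: "'k::comm_ring_1 tpoly" where "varX = [:[:[:0, 1:]:]:]"
definition varY :: "'k::comm_ring_1 tpoly" where "varY = [:[:0, 1:]:]"
definition varZ :: "'k::comm_ring_1 tpoly" where "varZ = [:0, 1:]"

definition tcoeff :: "'k::zero tpoly \<Rightarrow> nat \<Rightarrow> nat \<Rightarrow> nat \<Rightarrow> 'k" where
  "tcoeff F a b c = coeff (coeff (coeff F c) b) a"

definition homogeneous3 :: "'k::zero tpoly \<Rightarrow> nat \<Rightarrow> bool" where
  "homogeneous3 F d \<longleftrightarrow> (\<forall>a b c. tcoeff F a b c \<noteq> 0 \<longrightarrow> a + b + c = d)"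

definition subst3 :: "'k::comm_ring_1 tpoly \<Rightarrow> 'k tpoly \<Rightarrow> 'k tpoly \<Rightarrow> 'k tpoly \<Rightarrow> 'k tpoly" where
  "subst3 F A B C =
     (\<Sum>c\<le>degree F. \<Sum>b\<le>degree (coeff F c). \<Sum>a\<le>degree (coeff (coeff F c) b).
        const3 (tcoeff F a b c) * A ^ a * B ^ b * C ^ c)"

definition linform :: "'k::comm_ring_1^3^3 \<Rightarrow> 3 \<Rightarrow> 'k tpoly" where
  "linform M i = const3 (M$i$0) * varX + const3 (M$i$1) * varY + const3 (M$i$2) * varZ"

definition transform3 :: "'k::comm_ring_1 tpoly \<Rightarrow> 'k^3^3 \<Rightarrow> 'k tpoly" where
  "transform3 F M = subst3 F (linform M 0) (linform M 1) (linform M 2)"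

definition plane_curve :: "'k::comm_ring_1 tpoly \<Rightarrow> nat \<Rightarrow> bool" where
  "plane_curve F d \<longleftrightarrow> F \<noteq> 0 \<and> d \<ge> 1 \<and> homogeneous3 F d"

text \<open>The curve F = 0 is mapped onto itself by the projectivity induced by M
  (equivalently by M^{-1}): F \<circ> M is a nonzero scalar multiple of F.\<close>
definition invariant_under :: "'k::field tpoly \<Rightarrow> 'k^3^3 \<Rightarrow> bool" where
  "invariant_under F M \<longleftrightarrow> (\<exists>c. c \<noteq> 0 \<and> transform3 F M = const3 c * F)"

text \<open>Matrices with entries in F_q = {x. x^q = x} \<subseteq> K.\<close>
definition over_Fq :: "nat \<Rightarrow> 'k::field^3^3 \<Rightarrow> bool" where
  "over_Fq q M \<longleftrightarrow> (\<forall>i j. (M$i$j) ^ q = M$i$j)"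

text \<open>GL(3,q) and SL(3,q); PGL(3,q) and PSL(3,q) are their images modulo scalars,
  and scalar matrices act trivially on curves.\<close>
definition GL3 :: "nat \<Rightarrow> ('k::field^3^3) set" where
  "GL3 q = {M. over_Fq q M \<and> det M \<noteq> 0}"
definition SL3 :: "nat \<Rightarrow> ('k::field^3^3) set" where
  "SL3 q = {M. over_Fq q M \<and> det M = 1}"

text \<open>K is an algebraic closure of the prime field F_p (hence of F_q).\<close>
definition alg_closure_of_prime_field :: "nat \<Rightarrow> 'k::field itself \<Rightarrow> bool" where
  "alg_closure_of_prime_field p _ \<longleftrightarrow>
     CHAR('k) = p \<and> prime p \<and>
     (\<forall>f :: 'k poly. degree f > 0 \<longrightarrow> (\<exists>x. poly f x = 0)) \<and>
     (\<forall>x :: 'k. \<exists>f :: 'k poly. f \<noteq> 0 \<and> (\<forall>i. coeff f i \<in> range of_nat) \<and> poly f x = 0)"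

end

theory Submission
  imports Defs
begin

text \<open>Transvections have order \<open>p\<close>, so they fix \<open>F\<close> itself and not only up to a scalar.
  If a form \<open>X\<^sup>k H\<close> with \<open>X\<close> not dividing \<open>H\<close> is fixed by all transvections over \<open>Fq\<close>, then
  \<open>H\<close> restricted to \<open>X = 0\<close> is a form in \<open>Y\<^sup>q\<close> and \<open>Z\<^sup>q\<close>, so \<open>q\<close> divides \<open>deg H\<close>.  An irreducible
  \<open>F\<close> is not divisible by \<open>X\<close>, hence \<open>q\<close> divides \<open>d\<close>.

  Let \<open>c\<close> be the factor by which \<open>diag(1/t, 1, t)\<close> multiplies \<open>F\<close>.  The form
  \<open>G = F(X, Y, tZ) - c F\<close> vanishes on \<open>X = 0\<close> and is fixed by all transvections.  If it is nonzero,
  let \<open>X\<^sup>k\<close> be the exact power of \<open>X\<close> in \<open>G\<close>.  Then \<open>q\<close> divides \<open>d - k\<close>, so \<open>q\<close> divides \<open>k \<ge> 1\<close>.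
  By transitivity \<open>G\<close> vanishes to order \<open>k \<ge> q\<close> on each of the \<open>q\<^sup>2\<close> lines \<open>X + aY + bZ = 0\<close>,
  whence \<open>d \<ge> q\<^sup>3\<close>.  So \<open>G = 0\<close>, and \<open>GL(3,q)\<close> is generated by \<open>SL(3,q)\<close> and the \<open>diag(1, 1, t)\<close>.\<close>

section \<open>Univariate polynomials\<close>

text \<open>Linear factors split off one at a time: the other points stay roots of the cofactor
  because differences of distinct points cancel in a domain. Coefficients in a domain are allowed
  since \<open>K[X,Y]\<close> is the coefficient ring later.\<close>

lemma root_product_dvd:
  fixes p :: "'a::idom poly"
  assumes "finite T" and "\<And>t. t \<in> T \<Longrightarrow> poly p t = 0"
  shows "(\<Prod>t\<in>T. [:-t, 1:]) dvd p"
  using assms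
proof (induction T arbitrary: p)
  case (insert t T)
  then obtain r where r: "p = [:-t, 1:] * r"
    by (metis dvdE insertI1 poly_eq_0_iff_dvd)
  have "poly r u = 0" if "u \<in> T" for u
  proof -
    have "u \<noteq> t"
      using that insert.hyps by auto
    moreover have "(u - t) * poly r u = 0"
      using insert.prems[of u] that r by (simp add: algebra_simps)
    ultimately show ?thesis
      by simp
  qed
  then have "(\<Prod>t\<in>T. [:-t, 1:]) dvd r"
    by (rule insert.IH)
  then show ?case
    using insert.hyps r by (simp add: mult_dvd_mono del: mult_pCons_left)
qed simp

text \<open>Every factor is congruent to the variable modulo \<open>x\<close>. For \<open>S\<close>
  the field of order \<open>q\<close> the product is Z^q - x^(q-1) Z.\<close>

lemma scaled_root_product_cong:
  fixes x :: "'a::idom"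
  assumes "finite S"
  obtains r where "(\<Prod>s\<in>S. [:-(s * x), 1:]) = monom 1 (card S) + smult x r"
proof -
  have "\<exists>r. (\<Prod>s\<in>S. [:-(s * x), 1:]) = monom 1 (card S) + smult x r"
    using assms
  proof (induction S)
    case empty
    show ?case
      by (intro exI[of _ 0]) simp
  next
    case (insert s S)
    then obtain r where r: "(\<Prod>s\<in>S. [:-(s * x), 1:]) = monom 1 (card S) + smult x r"
      by blast
    have "[:-(s * x), 1:] * monom 1 (card S) =
        (smult x [:-s:] + [:0, 1:]) * monom 1 (card S)"
      by (simp add: mult.commute)
    also have "\<dots> = smult x ([:-s:] * monom 1 (card S)) + monom 1 (Suc (card S))"
      by (simp add: distrib_right monom_Suc)
    finally have "[:-(s * x), 1:] * (monom 1 (card S) + smult x r) =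
        monom 1 (Suc (card S)) + smult x ([:-s:] * monom 1 (card S) + [:-(s * x), 1:] * r)"
      by (simp only: distrib_left mult_smult_right smult_add_right add_ac)
    then show ?case
      using insert.hyps r by (simp del: mult_pCons_left) blast
  qed
  then show thesis
    using that by blast
qed

text \<open>Dividing by the translation-invariant product of the \<open>Z - s x\<close>, which is \<open>Z ^ q\<close>
  modulo \<open>x\<close>, shows by descent that an invariant polynomial is one in \<open>Z ^ q\<close> modulo \<open>x\<close>.\<close>

lemma translation_invariant_coeff_dvd:
  fixes P :: "'a::idom poly" and x :: 'a
  assumes S: "finite S" "0 \<in> S" "\<And>s t. s \<in> S \<Longrightarrow> t \<in> S \<Longrightarrow> s + t \<in> S"
    and x: "x \<noteq> 0"
    and inv: "\<And>s. s \<in> S \<Longrightarrow> pcompose P [:s * x, 1:] = P"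
    and c: "\<not> card S dvd c"
  shows "x dvd coeff P c"
  using inv c
proof (induction "degree P" arbitrary: P c rule: less_induct)
  case less
  define \<pi> where "\<pi> = (\<Prod>s\<in>S. [:-(s * x), 1:])"
  have card_pos: "card S > 0"
    using S by (auto simp: card_gt_0_iff)
  have inj: "inj_on (\<lambda>s. s * x) S"
    using x by (auto simp: inj_on_def)
  \<comment> \<open>Invariance gives \<open>P\<close> the same value at all points
    \<open>s * x\<close> as at 0.\<close>
  have "poly (P - [:poly P 0:]) t = 0" if t: "t \<in> (\<lambda>s. s * x) ` S" for t
  proof -
    obtain s where s: "s \<in> S" "t = s * x"
      using t by auto
    have "poly P t = poly (pcompose P [:s * x, 1:]) 0"
      using s by (simp add: poly_pcompose)
    then show ?thesis
      using less.prems(1) s by simp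
  qed
  then have "(\<Prod>t\<in>(\<lambda>s. s * x) ` S. [:-t, 1:]) dvd P - [:poly P 0:]"
    using S(1) by (intro root_product_dvd) auto
  then have "\<pi> dvd P - [:poly P 0:]"
    using inj by (simp add: \<pi>_def prod.reindex)
  then obtain Q where "P - [:poly P 0:] = \<pi> * Q"
    by (elim dvdE)
  then have Q: "P = [:poly P 0:] + \<pi> * Q"
    by (simp add: algebra_simps)
  show ?case
  proof (cases "Q = 0")
    case True
    then have "coeff P c = coeff [:poly P 0:] c"
      using Q by simp
    then show ?thesis
      using less.prems(2) by (cases c) auto
  next
    case False
    have deg\<pi>: "degree \<pi> = card S"
      unfolding \<pi>_def by (subst degree_prod_eq_sum_degree) auto
    have \<pi>0: "\<pi> \<noteq> 0"
      using deg\<pi> card_pos by auto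
    have degP: "degree P = card S + degree Q"
    proof -
      have d: "degree (\<pi> * Q) = card S + degree Q"
        using False \<pi>0 deg\<pi> by (simp add: degree_mult_eq)
      have "degree ([:poly P 0:] + \<pi> * Q) = degree (\<pi> * Q)"
        using d card_pos by (intro degree_add_eq_right) simp
      then show ?thesis
        using Q d by simp
    qed
    \<comment> \<open>The translation permutes the factors, as adding \<open>t\<close> is injective
      on the finite set \<open>S\<close> and maps it into itself.\<close>
    have shift: "pcompose \<pi> [:t * x, 1:] = \<pi>" if "t \<in> S" for t
    proof -
      have "inj_on (\<lambda>s. s + t) S"
        by (auto simp: inj_on_def)
      then have bij: "bij_betw (\<lambda>s. s + t) S S"
        using S that by (auto simp: bij_betw_def endo_inj_surj image_subset_iff)
      have "pcompose \<pi> [:t * x, 1:] = (\<Prod>s\<in>S. [:t * x - s * x, 1:])"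
        by (simp add: \<pi>_def pcompose_prod pcompose_pCons)
      also have "\<dots> = (\<Prod>s\<in>S. [:t * x - (s + t) * x, 1:])"
        by (rule prod.reindex_bij_betw[OF bij, symmetric])
      finally show ?thesis
        by (simp add: \<pi>_def algebra_simps)
    qed
    have invQ: "pcompose Q [:t * x, 1:] = Q" if "t \<in> S" for t
    proof -
      have "[:poly P 0:] + \<pi> * pcompose Q [:t * x, 1:] = pcompose P [:t * x, 1:]"
        by (subst (2) Q) (simp add: pcompose_add pcompose_mult shift[OF that])
      also have "\<dots> = [:poly P 0:] + \<pi> * Q"
        using less.prems(1)[OF that] Q by simp
      finally show ?thesis
        using \<pi>0 by simp
    qed
    obtain r where r: "\<pi> = monom 1 (card S) + smult x r"
      using scaled_root_product_cong[OF S(1)] unfolding \<pi>_def by blast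
    have "c > 0"
      using less.prems(2) by (cases c) auto
    then have "coeff P c = coeff (\<pi> * Q) c"
      by (subst Q) (simp add: coeff_pCons split: nat.splits)
    also have "\<dots> = coeff (monom 1 (card S) * Q) c + x * coeff (r * Q) c"
      by (simp add: r algebra_simps)
    finally have coeffP: "coeff P c = coeff (monom 1 (card S) * Q) c + x * coeff (r * Q) c" .
    \<comment> \<open>The monomial shifts indices by \<open>card S\<close>, which preserves
      non-divisibility, so the induction hypothesis for \<open>Q\<close> applies.\<close>
    have "x dvd coeff (monom 1 (card S) * Q) c"
    proof (cases "card S \<le> c")
      case True
      have "\<not> card S dvd c - card S"
        using True less.prems(2) dvd_minus_self[of "card S" c] by auto
      then have "x dvd coeff Q (c - card S)"
        using degP card_pos invQ by (intro less.hyps) auto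
      then show ?thesis
        using True by (simp add: coeff_monom_mult)
    qed (simp add: coeff_monom_mult)
    then show ?thesis
      using coeffP by simp
  qed
qed

text \<open>The sum of all root orders is at most the degree; \<open>k \<ge> 1\<close> makes every
  element of \<open>W\<close> a root.\<close>

lemma repeated_root_count_le_degree:
  fixes p :: "'a::idom poly"
  assumes "p \<noteq> 0" and "finite W" and "k \<ge> 1"
    and "\<And>w. w \<in> W \<Longrightarrow> [:-w, 1:] ^ k dvd p"
  shows "card W * k \<le> degree p"
proof -
  have ord: "k \<le> order w p" if "w \<in> W" for w
    using assms(1) assms(4)[OF that] by (simp add: order_divides)
  have root: "poly p w = 0" if "w \<in> W" for w
    using ord[OF that] assms(1,3) by (auto simp: order_root)
  have "card W * k = (\<Sum>w\<in>W. k)"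
    by simp
  also have "\<dots> \<le> (\<Sum>w\<in>W. order w p)"
    using ord by (intro sum_mono) auto
  also have "\<dots> \<le> (\<Sum>w | poly p w = 0. order w p)"
    using assms(1) root by (intro sum_mono2 poly_roots_finite) auto
  also have "\<dots> \<le> degree p"
    using assms(1) by (rule sum_order_le_degree)
  finally show ?thesis .
qed

section \<open>The subfield of order \<open>q\<close>\<close>

text \<open>After all distinct linear factors are removed, a root of the cofactor would be a double
  root of \<open>f\<close>, hence a root of the derivative. So the cofactor is constant.\<close>

lemma card_roots_eq_degree:
  fixes f :: "'k::field poly"
  assumes closed: "\<And>g :: 'k poly. degree g > 0 \<Longrightarrow> \<exists>x. poly g x = 0"
    and "f \<noteq> 0" and simple: "\<And>x. poly f x = 0 \<Longrightarrow> poly (pderiv f) x \<noteq> 0"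
  shows "card {x. poly f x = 0} = degree f"
proof -
  have fin: "finite {x. poly f x = 0}"
    using assms(2) by (rule poly_roots_finite)
  have "(\<Prod>t\<in>{x. poly f x = 0}. [:-t, 1:]) dvd f"
    using fin by (intro root_product_dvd) auto
  then obtain g where g: "f = (\<Prod>t\<in>{x. poly f x = 0}. [:-t, 1:]) * g"
    by (elim dvdE)
  have prod0: "(\<Prod>t\<in>{x. poly f x = 0}. [:-t, 1:]) \<noteq> 0" and "g \<noteq> 0"
    using g assms(2) by auto
  have "degree g = 0"
  proof (rule ccontr)
    assume "degree g \<noteq> 0"
    then obtain y where y: "poly g y = 0"
      using closed by blast
    then have fy: "poly f y = 0"
      by (subst g) simp
    have "f = [:-y, 1:] * (\<Prod>t\<in>{x. poly f x = 0} - {y}. [:-t, 1:]) * g"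
      using g prod.remove[OF fin, of y "\<lambda>t. [:-t, 1:]"] fy by simp
    moreover have "[:-y, 1:] dvd g"
      using y by (simp add: poly_eq_0_iff_dvd)
    ultimately have "[:-y, 1:] * [:-y, 1:] dvd f"
      by (metis mult_dvd_mono dvd_triv_left)
    then obtain h where "f = [:-y, 1:] * ([:-y, 1:] * h)"
      by (metis dvdE mult.assoc)
    then have "poly (pderiv f) y = 0"
      by (simp add: pderiv_mult pderiv_pCons del: mult_pCons_left)
    then show False
      using simple[OF fy] by simp
  qed
  then have "degree f = degree (\<Prod>t\<in>{x. poly f x = 0}. [:-t, 1:])"
    using prod0 \<open>g \<noteq> 0\<close> by (subst g) (simp add: degree_mult_eq)
  also have "\<dots> = card {x. poly f x = 0}"
    by (subst degree_prod_eq_sum_degree) auto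
  finally show ?thesis ..
qed

text \<open>In characteristic \<open>p\<close> the polynomial X^q - X has derivative -1, so all its
  roots are simple.\<close>

lemma card_Fq:
  assumes "alg_closure_of_prime_field p TYPE('k::field)" and q: "q = p ^ n" "n \<ge> 1"
  shows "card {x::'k. x ^ q = x} = q" and "finite {x::'k. x ^ q = x}"
proof -
  have char: "CHAR('k) = p" "prime p"
    and closed: "\<And>g :: 'k poly. degree g > 0 \<Longrightarrow> \<exists>x. poly g x = 0"
    using assms(1) by (auto simp: alg_closure_of_prime_field_def)
  define f :: "'k poly" where "f = monom 1 q + [:0, -1:]"
  have "q > 1"
    using q prime_gt_1_nat[OF char(2)] by (metis One_nat_def Suc_le_lessD one_less_power)
  then have degf: "degree f = q"
    unfolding f_def by (subst degree_add_eq_left) (auto simp: degree_monom_eq)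
  have f0: "f \<noteq> 0"
    using degf \<open>q > 1\<close> by auto
  have "of_nat q = (0 :: 'k)"
    using q char by (simp add: of_nat_eq_0_iff_char_dvd)
  then have "pderiv f = -1"
    by (simp add: f_def pderiv_add pderiv_monom pderiv_pCons one_pCons)
  then have "card {x. poly f x = 0} = degree f"
    using closed f0 by (intro card_roots_eq_degree) auto
  moreover have "{x. poly f x = 0} = {x. x ^ q = x}"
    by (auto simp: f_def poly_monom)
  ultimately show "card {x::'k. x ^ q = x} = q" "finite {x::'k. x ^ q = x}"
    using degf poly_roots_finite[OF f0] by auto
qed

text \<open>\<open>K\<close> contains sets of \<open>p ^ n\<close> elements for every
  \<open>n \<ge> 1\<close>, which exceeds any finite cardinality.\<close>

lemma infinite_UNIV_alg_closure:
  assumes "alg_closure_of_prime_field p TYPE('k::field)"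
  shows "infinite (UNIV :: 'k set)"
proof
  assume fin: "finite (UNIV :: 'k set)"
  have "p > 1"
    using assms prime_gt_1_nat by (auto simp: alg_closure_of_prime_field_def)
  define n where "n = Suc (card (UNIV :: 'k set))"
  have "p ^ n = card {x::'k. x ^ (p ^ n) = x}"
    using card_Fq(1)[OF assms refl, of n] by (simp add: n_def del: power_Suc)
  also have "\<dots> \<le> card (UNIV :: 'k set)"
    using fin by (intro card_mono) auto
  also have "\<dots> < n"
    by (simp add: n_def)
  finally show False
    using power_gt_expt[of p n] \<open>p > 1\<close> by simp
qed

section \<open>Ternary forms as functions\<close>

lemma index3_three: "(3::3) = 0"
  by simp

lemma index3_cases: "(i::3) = 0 \<or> i = 1 \<or> i = 2"
  using exhaust_3[of i] by auto

lemma index3_exhaust: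
  obtains "(i::3) = 0" | "i = 1" | "i = 2"
  using index3_cases by blast

lemma index3_all: "(\<forall>i::3. P i) \<longleftrightarrow> P 0 \<and> P 1 \<and> P 2"
  by (metis index3_cases)

lemma sum_index3: "sum f (UNIV :: 3 set) = f 0 + f 1 + f 2"
  by (simp add: sum_3 index3_three ac_simps)

lemma det_index3:
  fixes A :: "'a::comm_ring_1^3^3"
  shows "det A = A$0$0 * A$1$1 * A$2$2 + A$0$1 * A$1$2 * A$2$0 + A$0$2 * A$1$0 * A$2$1
    - A$0$0 * A$1$2 * A$2$1 - A$0$1 * A$1$0 * A$2$2 - A$0$2 * A$1$1 * A$2$0"
  by (simp add: det_3 index3_three algebra_simps)

definition vec3 :: "'a \<Rightarrow> 'a \<Rightarrow> 'a \<Rightarrow> 'a^3" where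
  "vec3 x y z = (\<chi> i. if i = 0 then x else if i = 1 then y else z)"

lemma vec3_nth [simp]: "vec3 x y z $ 0 = x" "vec3 x y z $ 1 = y" "vec3 x y z $ 2 = z"
  by (simp_all add: vec3_def)

lemma vec3_eq_iff: "v = w \<longleftrightarrow> v$0 = w$0 \<and> v$1 = w$1 \<and> v$2 = w$(2::3)"
  by (simp add: vec_eq_iff index3_all)

lemma axis_other: "j \<noteq> i \<Longrightarrow> axis i a $ j = 0"
  by (simp add: axis_def)

lemma vec3_axis:
  "vec3 x y z + axis 0 a = vec3 (x + a) y z"
  "vec3 x y z + axis 1 a = vec3 x (y + a) z"
  "vec3 x y z + axis 2 a = vec3 x y (z + a)" for a :: "'a::monoid_add"
  by (simp_all add: vec3_eq_iff axis_def)

text \<open>The outermost variable Z is evaluated first, so the values for Z and Y enter as constant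
  polynomials. On values, substitutions become maps of points.\<close>

definition ev3 :: "'k::comm_ring_1 tpoly \<Rightarrow> 'k^3 \<Rightarrow> 'k" where
  "ev3 F v = poly (poly (poly F [:[:v$2:]:]) [:v$1:]) (v$0)"

lemma ev3_ring_hom [simp]:
  "ev3 0 v = 0"
  "ev3 1 v = 1"
  "ev3 (F + G) v = ev3 F v + ev3 G v"
  "ev3 (F - G) v = ev3 F v - ev3 G v"
  "ev3 (F * G) v = ev3 F v * ev3 G v"
  "ev3 (F ^ n) v = ev3 F v ^ n"
  "ev3 (sum f A) v = (\<Sum>x\<in>A. ev3 (f x) v)"
  "ev3 (const3 c) v = c"
  "ev3 varX v = v$0" "ev3 varY v = v$1" "ev3 varZ v = v$2"
  by (simp_all add: ev3_def poly_power poly_sum const3_def varX_def varY_def varZ_def)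

lemma poly_poly_poly:
  "poly (poly (poly P u) [:y:]) x = poly (poly (poly P [:[:poly (poly u [:y:]) x:]:]) [:y:]) x"
  by (induction P) auto

text \<open>Composition in the outer variable substitutes r(X,Y) + tZ for Z. This covers both the
  transvections Z + aX and the homology tZ.\<close>

lemma ev3_pcompose_linear:
  "ev3 (pcompose F [:r, [:[:t:]:]:]) v = ev3 F (vec3 (v$0) (v$1) (poly (poly r [:v$1:]) (v$0) + t * v$2))"
proof -
  have "ev3 (pcompose F [:r, [:[:t:]:]:]) v = poly (poly (poly F (r + [:[:v$2:]:] * [:[:t:]:])) [:v$1:]) (v$0)"
    by (simp add: ev3_def poly_pcompose)
  also have "\<dots> = poly (poly (poly F [:[:poly (poly (r + [:[:v$2:]:] * [:[:t:]:]) [:v$1:]) (v$0):]:]) [:v$1:]) (v$0)"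
    by (rule poly_poly_poly)
  finally show ?thesis
    by (simp add: ev3_def mult.commute)
qed

lemma ev3_altdef:
  "ev3 F v = (\<Sum>c\<le>degree F. \<Sum>b\<le>degree (coeff F c). \<Sum>a\<le>degree (coeff (coeff F c) b).
        tcoeff F a b c * v$0 ^ a * v$1 ^ b * v$2 ^ c)"
proof -
  have "ev3 F v = (\<Sum>c\<le>degree F. poly (poly (coeff F c) [:v$1:]) (v$0) * v$2 ^ c)"
    unfolding ev3_def by (subst poly_altdef) (simp add: poly_sum poly_power)
  also have "\<dots> = (\<Sum>c\<le>degree F. (\<Sum>b\<le>degree (coeff F c).
      poly (coeff (coeff F c) b) (v$0) * v$1 ^ b) * v$2 ^ c)"
    by (subst poly_altdef[of "coeff F _"]) (simp add: poly_sum poly_power)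
  also have "\<dots> = (\<Sum>c\<le>degree F. (\<Sum>b\<le>degree (coeff F c).
      (\<Sum>a\<le>degree (coeff (coeff F c) b). tcoeff F a b c * v$0 ^ a) * v$1 ^ b) * v$2 ^ c)"
    by (simp add: poly_altdef tcoeff_def)
  finally show ?thesis
    by (simp add: sum_distrib_right)
qed

lemma ev3_subst3: "ev3 (subst3 F A B C) v = ev3 F (vec3 (ev3 A v) (ev3 B v) (ev3 C v))"
  by (simp add: subst3_def ev3_altdef[of F])

lemma ev3_transform3: "ev3 (transform3 F M) v = ev3 F (M *v v)"
proof -
  have "vec3 (ev3 (linform M 0) v) (ev3 (linform M 1) v) (ev3 (linform M 2) v) = M *v v"
    by (simp add: vec3_eq_iff linform_def matrix_vector_mult_def sum_index3)
  then show ?thesis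
    by (simp add: transform3_def ev3_subst3)
qed

lemma poly_eqI_infinite:
  fixes p q :: "'a::idom poly"
  assumes "infinite A" and "\<And>x. x \<in> A \<Longrightarrow> poly p x = poly q x"
  shows "p = q"
proof (rule ccontr)
  assume "p \<noteq> q"
  then have "finite {x. poly (p - q) x = 0}"
    by (intro poly_roots_finite) simp
  moreover have "A \<subseteq> {x. poly (p - q) x = 0}"
    using assms(2) by auto
  ultimately show False
    using assms(1) finite_subset by blast
qed

text \<open>One variable is freed at a time: the constants form an infinite subset of each
  coefficient domain, and agreement there forces equality.\<close>

lemma ev3_eqI:
  fixes P Q :: "'k::field tpoly"
  assumes inf: "infinite (UNIV :: 'k set)" and eq: "\<And>v. ev3 P v = ev3 Q v"
  shows "P = Q"
proof -
  have inj: "inj (\<lambda>y::'k. [:y:])" "inj (\<lambda>y::'k. [:[:y:]:])"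
    by (auto simp: inj_def)
  then have inf2: "infinite (range (\<lambda>y::'k. [:y:]))" "infinite (range (\<lambda>y::'k. [:[:y:]:]))"
    using inf finite_imageD by blast+
  have "poly (poly (poly P [:[:z:]:]) [:y:]) x = poly (poly (poly Q [:[:z:]:]) [:y:]) x" for x y z
    using eq[of "vec3 x y z"] by (simp add: ev3_def)
  then have "poly (poly P [:[:z:]:]) [:y:] = poly (poly Q [:[:z:]:]) [:y:]" for y z
    using inf by (intro poly_eqI_infinite) auto
  then have "poly P [:[:z:]:] = poly Q [:[:z:]:]" for z
    using inf2(1) by (intro poly_eqI_infinite[of "range (\<lambda>y. [:y:])"]) auto
  then show ?thesis
    using inf2(2) by (intro poly_eqI_infinite[of "range (\<lambda>y. [:[:y:]:])"]) auto
qed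

section \<open>Divisibility by X and restriction to the line X = 0\<close>

lemma varX_power: "varX ^ k = [:[:monom 1 k:]:]"
  by (simp add: varX_def poly_const_pow monom_altdef)

lemma tcoeff_varX_power_mult: "tcoeff (varX ^ k * F) (i + k) j l = tcoeff F i j l"
  by (simp add: tcoeff_def varX_power coeff_monom_mult)

lemma homogeneous3_varX_power_mult:
  assumes "homogeneous3 (varX ^ k * F) d"
  shows "homogeneous3 F (d - k)"
proof -
  have "i + k + j + l = d" if "tcoeff F i j l \<noteq> 0" for i j l
    using assms that unfolding homogeneous3_def by (metis tcoeff_varX_power_mult)
  then show ?thesis
    unfolding homogeneous3_def by fastforce
qed

lemma pcompose_power: "pcompose (p ^ k) r = pcompose p r ^ k" for p r :: "'a::comm_semiring_1 poly"
  by (induction k) (simp_all add: pcompose_mult pcompose_1)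

lemma X_dvd_iff: "[:0, 1:] dvd p \<longleftrightarrow> coeff p 0 = 0" for p :: "'k::field poly"
  using poly_eq_0_iff_dvd[of p 0] by (simp add: poly_0_coeff_0)

lemma varX_dvd_iff:
  fixes F :: "'k::field tpoly"
  shows "varX dvd F \<longleftrightarrow> (\<forall>j l. tcoeff F 0 j l = 0)"
  by (auto simp: varX_def const_poly_dvd_iff X_dvd_iff tcoeff_def)

lemma poly_altdef_le:
  "degree p \<le> n \<Longrightarrow> poly p x = (\<Sum>i\<le>n. coeff p i * x ^ i)" for x :: "'a::comm_semiring_1"
  unfolding poly_altdef by (intro sum.mono_neutral_left) (auto simp: coeff_eq_0)

text \<open>With X absent, homogeneity leaves the single exponent \<open>e - l\<close> of Y beside
  \<open>z ^ l\<close>.\<close>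

lemma homogeneous3_ev3_X0:
  fixes F :: "'k::field tpoly"
  assumes hom: "homogeneous3 F e"
  shows "ev3 F (vec3 0 y z) = (\<Sum>l\<le>e. tcoeff F 0 (e - l) l * y ^ (e - l) * z ^ l)"
proof -
  have degF: "degree F \<le> e"
  proof (rule degree_le, intro allI impI)
    fix l assume "e < l"
    then have "coeff (coeff (coeff F l) j) i = 0" for i j
      using hom unfolding homogeneous3_def tcoeff_def by fastforce
    then show "coeff F l = 0"
      by (simp add: poly_eq_iff)
  qed
  have inner: "poly (poly (coeff F l) [:y:]) 0 = tcoeff F 0 (e - l) l * y ^ (e - l)" if "l \<le> e" for l
  proof -
    \<comment> \<open>The bound must reach the index \<open>e - l\<close>, which may exceed the
      degree, as well as every nonzero coefficient.\<close>
    let ?n = "max (e - l) (degree (coeff F l))"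
    have "poly (poly (coeff F l) [:y:]) 0 = (\<Sum>j\<le>?n. tcoeff F 0 j l * y ^ j)"
      by (subst poly_altdef_le[of _ ?n])
        (auto simp: tcoeff_def poly_0_coeff_0 coeff_sum poly_const_pow mult.commute)
    also have "\<dots> = (\<Sum>j\<le>?n. if j = e - l then tcoeff F 0 j l * y ^ j else 0)"
      using hom unfolding homogeneous3_def by (intro sum.cong) fastforce+
    finally show ?thesis
      by simp
  qed
  have "ev3 F (vec3 0 y z) = (\<Sum>l\<le>e. poly (poly (coeff F l) [:y:]) 0 * z ^ l)"
    by (simp add: ev3_def poly_altdef_le[OF degF] poly_sum poly_power)
  then show ?thesis
    using inner by simp
qed

lemma coeff_poly_const_arg: "coeff (poly p [:c:]) j = (\<Sum>i\<le>degree p. coeff (coeff p i) j * c ^ i)"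
  for p :: "'a::comm_ring_1 poly poly"
  by (simp add: poly_altdef coeff_sum poly_const_pow mult.commute)

lemma homogeneous3_degree_restriction:
  fixes F :: "'k::field tpoly"
  assumes hom: "homogeneous3 F d"
  shows "degree (poly (poly F [:[:z:]:]) [:y:]) \<le> d"
proof (rule degree_le, intro allI impI)
  fix i assume "d < i"
  then have "coeff (coeff (coeff F l) j) i = 0" for j l
    using hom unfolding homogeneous3_def tcoeff_def by fastforce
  then show "coeff (poly (poly F [:[:z:]:]) [:y:]) i = 0"
    by (simp add: coeff_poly_const_arg coeff_sum poly_const_pow)
qed

text \<open>Values are fixed exactly, not up to a scalar, so that differences of fixed forms are
  fixed as well.\<close>

definition transv_inv :: "nat \<Rightarrow> 'k::field tpoly \<Rightarrow> bool" where
  "transv_inv q F \<longleftrightarrow>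
     (\<forall>i j a v. i \<noteq> j \<longrightarrow> a ^ q = a \<longrightarrow> ev3 F (v + axis i (a * v$j)) = ev3 F v)"

lemma transv_invD:
  "transv_inv q F \<Longrightarrow> i \<noteq> j \<Longrightarrow> a ^ q = a \<Longrightarrow> ev3 F (v + axis i (a * v$j)) = ev3 F v"
  by (simp add: transv_inv_def)

section \<open>Forms fixed by transvections\<close>

locale alg_closure_of_Fq =
  fixes p n q :: nat and K :: "'k::field itself"
  assumes closure: "alg_closure_of_prime_field p K"
    and q_eq: "q = p ^ n" and n_ge_1: "n \<ge> 1"
begin

definition Fq :: "'k set" where
  "Fq = {x. x ^ q = x}"

lemma char: "CHAR('k) = p" "prime p"
  using closure by (auto simp: alg_closure_of_prime_field_def)

lemma infinite_field: "infinite (UNIV :: 'k set)"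
  using infinite_UNIV_alg_closure closure unfolding alg_closure_of_prime_field_def by blast

lemma q_pos: "q > 0"
  using q_eq char prime_gt_0_nat by simp

lemma finite_Fq: "finite Fq" and card_Fq_eq: "card Fq = q"
  using card_Fq[of p q n] closure q_eq n_ge_1
  unfolding Fq_def alg_closure_of_prime_field_def by blast+

lemma power_q_add: "(x + y :: 'k) ^ q = x ^ q + y ^ q"
  using char q_eq by (intro freshmans_dream') auto

lemma power_q_uminus: "(- x :: 'k) ^ q = - (x ^ q)"
proof -
  have "x ^ q + (- x) ^ q = (x + - x) ^ q"
    by (rule power_q_add[symmetric])
  also have "\<dots> = 0"
    using q_pos by simp
  finally show ?thesis
    by (simp add: eq_neg_iff_add_eq_0 add.commute)
qed

lemma Fq_closed:
  "0 \<in> Fq" "1 \<in> Fq"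
  "x \<in> Fq \<Longrightarrow> y \<in> Fq \<Longrightarrow> x + y \<in> Fq"
  "x \<in> Fq \<Longrightarrow> y \<in> Fq \<Longrightarrow> x - y \<in> Fq"
  "x \<in> Fq \<Longrightarrow> y \<in> Fq \<Longrightarrow> x * y \<in> Fq"
  "x \<in> Fq \<Longrightarrow> - x \<in> Fq"
  "x \<in> Fq \<Longrightarrow> inverse x \<in> Fq"
  "x \<in> Fq \<Longrightarrow> y \<in> Fq \<Longrightarrow> x / y \<in> Fq"
  using q_pos power_q_add[of x "- y"]
  by (auto simp: Fq_def power_q_add power_q_uminus power_mult_distrib power_inverse power_divide)

lemma over_Fq_iff: "over_Fq q M \<longleftrightarrow> (\<forall>i j. (M$i$j :: 'k) \<in> Fq)"
  by (simp add: over_Fq_def Fq_def)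

lemma det_in_Fq:
  assumes "over_Fq q (M :: 'k^3^3)"
  shows "det M \<in> Fq"
  using assms unfolding over_Fq_iff det_index3 by (intro Fq_closed) auto

lemma transv_inv_Fq:
  "transv_inv q G \<Longrightarrow> i \<noteq> j \<Longrightarrow> a \<in> Fq \<Longrightarrow> ev3 G (v + axis i (a * v$j)) = ev3 G (v :: 'k^3)"
  by (simp add: transv_inv_def Fq_def)

lemma invariant_under_SL3_imp_transv_inv:
  fixes F :: "'k tpoly"
  assumes "F \<noteq> 0" and SL: "\<forall>M \<in> SL3 q. invariant_under F M"
  shows "transv_inv q F"
  unfolding transv_inv_def
proof (intro allI impI)
  fix i j :: 3 and a :: 'k and v :: "'k^3"
  assume ij: "i \<noteq> j" and a: "a ^ q = a"
  define M :: "'k^3^3" where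
    "M = (\<chi> r s. (if r = s then 1 else 0) + (if r = i \<and> s = j then a else 0))"
  have "over_Fq q M"
    using a ij Fq_closed(1,2) by (auto simp: over_Fq_iff M_def Fq_def)
  moreover have "det M = 1"
    unfolding det_index3 M_def using ij
    by (cases i rule: index3_exhaust; cases j rule: index3_exhaust) simp_all
  ultimately have "M \<in> SL3 q"
    by (simp add: SL3_def)
  then obtain c where "transform3 F M = const3 c * F"
    using SL unfolding invariant_under_def by blast
  then have "ev3 F (M *v w) = c * ev3 F w" for w
    by (metis ev3_transform3 ev3_ring_hom(5,8))
  moreover have "M *v w = w + axis i (a * w$j)" for w
    unfolding matrix_vector_mult_def M_def using ij
    by (cases i rule: index3_exhaust; cases j rule: index3_exhaust)
      (simp_all add: vec3_eq_iff sum_index3 axis_def algebra_simps)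
  ultimately have step: "ev3 F (w + axis i (a * w$j)) = c * ev3 F w" for w
    by metis
  have axis0: "axis i 0 = (0 :: 'k^3)"
    by (simp add: vec_eq_iff axis_def)
  \<comment> \<open>Since \<open>i \<noteq> j\<close>, coordinate \<open>j\<close> is untouched, so
    repeating the transvection adds up its parameters. At \<open>m = p\<close> it becomes the
    identity.\<close>
  have iter: "ev3 F (w + axis i (of_nat m * a * w$j)) = c ^ m * ev3 F w" for m w
  proof (induction m)
    case 0
    show ?case
      by (simp add: axis0)
  next
    case (Suc m)
    let ?w = "w + axis i (of_nat m * a * w$j)"
    have "w + axis i (of_nat (Suc m) * a * w$j) = ?w + axis i (a * ?w$j)"
      using ij by (simp add: vec_eq_iff axis_def algebra_simps)
    then have "ev3 F (w + axis i (of_nat (Suc m) * a * w$j)) = c * ev3 F ?w"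
      using step[of ?w] by metis
    also have "ev3 F ?w = c ^ m * ev3 F w"
      by (rule Suc.IH)
    finally show ?case
      by (simp only: power_Suc mult.assoc)
  qed
  have "\<exists>w. ev3 F w \<noteq> 0"
    using ev3_eqI[OF infinite_field, of F 0] assms(1) by auto
  then obtain w where w: "ev3 F w \<noteq> 0"
    by blast
  have "of_nat p = (0 :: 'k)"
    using char by (simp add: of_nat_eq_0_iff_char_dvd)
  then have "c ^ p = 1"
    using iter[of w p] w by (simp add: axis0)
  \<comment> \<open>In characteristic \<open>p\<close> the only \<open>p\<close>-th root of unity is
    1.\<close>
  moreover have "(c - 1 + 1) ^ p = (c - 1) ^ p + 1 ^ p"
    using char by (intro freshmans_dream) auto
  ultimately have "(c - 1) ^ p = 0"
    by simp
  then have "c = 1"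
    by simp
  then show "ev3 F (v + axis i (a * v$j)) = ev3 F v"
    using step by simp
qed

text \<open>Rewrites a transvection as a translation of Z by \<open>a\<close> times X, the form to
  which \<open>translation_invariant_coeff_dvd\<close> applies.\<close>

lemma transv_inv_translate:
  fixes G :: "'k tpoly"
  assumes "transv_inv q G" and "a \<in> Fq"
  shows "pcompose G [:[:[:0, a:]:], 1:] = G"
proof (rule ev3_eqI[OF infinite_field])
  fix v :: "'k^3"
  have "ev3 (pcompose G [:[:[:0, a:]:], [:[:1:]:]:]) v = ev3 G (v + axis 2 (a * v$0))"
    unfolding ev3_pcompose_linear
    by (rule arg_cong[of _ _ "ev3 G"]) (simp add: vec3_eq_iff axis_other mult.commute)
  then show "ev3 (pcompose G [:[:[:0, a:]:], 1:]) v = ev3 G v"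
    using transv_inv_Fq[OF assms(1) _ assms(2), of 2 0 v] by (simp add: one_pCons)
qed

text \<open>Three shears produce the quarter turn: add Z to Y, subtract Y from Z, add Z to
  Y.\<close>

lemma transv_inv_rotate:
  fixes G :: "'k tpoly"
  assumes "transv_inv q G"
  shows "ev3 G (vec3 x z (- y)) = ev3 G (vec3 x y z)"
proof -
  have "ev3 G (vec3 x y z) = ev3 G (vec3 x (y + z) z)"
    using transv_inv_Fq[OF assms, of 1 2 1 "vec3 x y z"] Fq_closed(2) by (simp add: vec3_axis)
  also have "\<dots> = ev3 G (vec3 x (y + z) (- y))"
    using transv_inv_Fq[OF assms, of 2 1 "-1" "vec3 x (y + z) z"] Fq_closed(6)[OF Fq_closed(2)]
    by (simp add: vec3_axis)
  also have "\<dots> = ev3 G (vec3 x z (- y))"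
    using transv_inv_Fq[OF assms, of 1 2 1 "vec3 x (y + z) (- y)"] Fq_closed(2)
    by (simp add: vec3_axis)
  finally show ?thesis ..
qed

text \<open>The rotation \<open>(Y, Z) \<mapsto> (Z, -Y)\<close>, a product of transvections, carries
  divisibility of the exponents of \<open>Z\<close> over to those of \<open>Y\<close>.\<close>

lemma q_dvd_cofactor_degree:
  fixes F :: "'k tpoly"
  assumes inv: "transv_inv q (varX ^ k * F)" and hom: "homogeneous3 F e"
    and ndvd: "\<not> varX dvd F"
  shows "q dvd e"
proof -
  \<comment> \<open>Here \<open>?x\<close> is X inside \<open>K[X,Y]\<close>, and the translation
    set is the subfield embedded as constants.\<close>
  let ?x = "[:[:0, 1:]:] :: 'k poly poly" and ?S = "(\<lambda>a::'k. [:[:a:]:]) ` Fq"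
  have cardS: "card ?S = q"
    using card_Fq_eq by (subst card_image) (auto simp: inj_on_def)
  have "pcompose F [:s * ?x, 1:] = F" if "s \<in> ?S" for s
  proof -
    obtain a where a: "a \<in> Fq" "s = [:[:a:]:]"
      using \<open>s \<in> ?S\<close> by auto
    have "varX ^ k * pcompose F [:s * ?x, 1:] = pcompose (varX ^ k * F) [:s * ?x, 1:]"
      by (simp add: varX_power pcompose_smult)
    also have "\<dots> = varX ^ k * F"
      using transv_inv_translate[OF inv a(1)] a(2) by simp
    finally show ?thesis
      by (simp add: varX_def)
  qed
  then have "\<not> q dvd l \<Longrightarrow> ?x dvd coeff F l" for l
    using finite_Fq Fq_closed(1,3) cardS
    by (intro translation_invariant_coeff_dvd[of ?S ?x F l]) auto
  then have q_dvd: "q dvd l" if "tcoeff F 0 j l \<noteq> 0" for j l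
    using that unfolding const_poly_dvd_iff X_dvd_iff tcoeff_def by blast
  define C where "C l = tcoeff F 0 (e - l) l" for l
  \<comment> \<open>The rotation is known only for \<open>varX ^ k * F\<close>, where setting X = 0
    would lose \<open>F\<close>. The power is therefore cancelled as a polynomial in X
    first.\<close>
  have rot: "ev3 F (vec3 0 1 (- y)) = ev3 F (vec3 0 y 1)" for y
  proof -
    define A B where "A = poly (poly F [:[:- y:]:]) [:1:]" and "B = poly (poly F [:[:1:]:]) [:y:]"
    have "poly ([:0, 1:] ^ k * A) x = poly ([:0, 1:] ^ k * B) x" for x
      using transv_inv_rotate[OF inv, of x 1 y]
      by (simp add: A_def B_def ev3_def[of F] poly_power)
    then have "[:0, 1:] ^ k * A = [:0, 1:] ^ k * B"
      using infinite_field by (intro poly_eqI_infinite) auto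
    then have "A = B"
      by simp
    then show ?thesis
      by (simp add: A_def B_def ev3_def)
  qed
  \<comment> \<open>These are F(0,1,T) and F(0,T,1), so exchanging Y and Z reverses the
    coefficients. The rotation turns this into a symmetry of \<open>C\<close> up to sign.\<close>
  define u v where "u = (\<Sum>l\<le>e. monom (C l) l)" and "v = (\<Sum>l\<le>e. monom (C (e - l)) l)"
  have "v = pcompose u [:0, -1:]"
  proof (rule poly_eqI_infinite[OF infinite_field])
    fix y
    have "poly v y = (\<Sum>l\<le>e. C l * y ^ (e - l))"
      unfolding v_def poly_sum poly_monom
      by (rule sum.reindex_bij_witness[of _ "\<lambda>l. e - l" "\<lambda>l. e - l"]) auto
    also have "\<dots> = ev3 F (vec3 0 y 1)"
      by (simp add: homogeneous3_ev3_X0[OF hom] C_def)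
    also have "\<dots> = ev3 F (vec3 0 1 (- y))"
      by (rule rot[symmetric])
    also have "\<dots> = poly (pcompose u [:0, -1:]) y"
      by (simp add: homogeneous3_ev3_X0[OF hom] C_def u_def poly_pcompose poly_sum poly_monom)
    finally show "poly v y = poly (pcompose u [:0, -1:]) y" .
  qed
  then have "coeff v j = (-1) ^ j * coeff u j" for j
    by (simp add: coeff_pcompose_linear)
  moreover have "coeff u j = C j" "coeff v j = C (e - j)" if "j \<le> e" for j
    using that by (simp_all add: u_def v_def coeff_sum if_distrib cong: if_cong)
  ultimately have sym: "C (e - j) = (-1) ^ j * C j" if "j \<le> e" for j
    using that by metis
  \<comment> \<open>For this monomial \<open>q\<close> divides \<open>l\<close> directly; by the
    symmetry \<open>C j\<close> is nonzero too, so \<open>q\<close> divides \<open>j\<close> and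
    hence \<open>j + l\<close>.\<close>
  obtain j l where jl: "tcoeff F 0 j l \<noteq> 0"
    using ndvd varX_dvd_iff by blast
  then have e: "j + l = e"
    using hom unfolding homogeneous3_def by (metis add_0)
  have "C j \<noteq> 0"
    using sym[of j] jl e by (auto simp: C_def)
  then have "q dvd j"
    unfolding C_def by (rule q_dvd)
  then show ?thesis
    using q_dvd[OF jl] e by auto
qed

text \<open>Transvections move \<open>X = 0\<close> to the \<open>q\<^sup>2\<close> lines \<open>X + a Y + b Z = 0\<close>, which meet a line
  \<open>(Y, Z) = (y\<^sub>0, z\<^sub>0)\<close> in distinct points as soon as \<open>y\<^sub>0 / z\<^sub>0\<close> is not in \<open>Fq\<close>.\<close>

lemma line_multiplicity_bound:
  fixes F :: "'k tpoly"
  assumes inv: "transv_inv q (varX ^ k * F)" and "F \<noteq> 0" and k: "k \<ge> 1"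
    and hom: "homogeneous3 (varX ^ k * F) d"
  shows "q ^ 2 * k \<le> d"
proof -
  define G where "G = varX ^ k * F"
  have "G \<noteq> 0"
    using \<open>F \<noteq> 0\<close> by (simp add: G_def varX_def)
  \<comment> \<open>Only finitely many values of \<open>z\<close>, and then of \<open>y\<close>,
    make the restriction of \<open>G\<close> vanish identically, so generic ones exist.\<close>
  have "finite ((\<lambda>z. [:[:z:]:]) -` {r. poly G r = 0} :: 'k set)"
    using \<open>G \<noteq> 0\<close> by (intro finite_vimageI poly_roots_finite) (auto simp: inj_def)
  then have "finite (insert 0 ((\<lambda>z. [:[:z:]:]) -` {r. poly G r = 0}))"
    by simp
  then obtain z where z: "z \<noteq> 0" "poly G [:[:z:]:] \<noteq> 0"
    using ex_new_if_finite[OF infinite_field] by blast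
  have "finite ((\<lambda>y. [:y:]) -` {r. poly (poly G [:[:z:]:]) r = 0} :: 'k set)"
    using z(2) by (intro finite_vimageI poly_roots_finite) (auto simp: inj_def)
  then have "finite ((\<lambda>s. s * z) ` Fq \<union> (\<lambda>y. [:y:]) -` {r. poly (poly G [:[:z:]:]) r = 0})"
    using finite_Fq by simp
  then obtain y where y: "y \<notin> (\<lambda>s. s * z) ` Fq" "poly (poly G [:[:z:]:]) [:y:] \<noteq> 0"
    using ex_new_if_finite[OF infinite_field] by blast
  define g where "g = poly (poly G [:[:z:]:]) [:y:]"
  define g' where "g' = poly (poly F [:[:z:]:]) [:y:]"
  have g: "g = [:0, 1:] ^ k * g'"
    by (simp add: g_def g'_def G_def varX_def poly_power)
  let ?w = "\<lambda>(a, b). a * y + b * z"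
  have inj: "inj_on (\<lambda>ab. - ?w ab) (Fq \<times> Fq)"
  proof (rule inj_onI)
    fix s t assume st: "s \<in> Fq \<times> Fq" "t \<in> Fq \<times> Fq" "- ?w s = - ?w t"
    obtain a b a' b' where ab: "s = (a, b)" "t = (a', b')"
      by fastforce
    have eq: "(a - a') * y = (b' - b) * z"
      using st(3) ab by (simp add: algebra_simps)
    have "a = a'"
    proof (rule ccontr)
      assume "a \<noteq> a'"
      then have "y = ((b' - b) / (a - a')) * z"
        using eq by (simp add: field_simps)
      moreover have "(b' - b) / (a - a') \<in> Fq"
        using st ab by (auto intro: Fq_closed)
      ultimately show False
        using y(1) by blast
    qed
    then show "s = t"
      using eq z(1) ab by simp
  qed
  have "[:-w, 1:] ^ k dvd g" if "w \<in> (\<lambda>ab. - ?w ab) ` (Fq \<times> Fq)" for w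
  proof -
    obtain a b where ab: "a \<in> Fq" "b \<in> Fq" "w = - (a * y + b * z)"
      using \<open>w \<in> _\<close> by auto
    \<comment> \<open>Two transvections shift X by \<open>a * y + b * z\<close>, carrying the root 0
      of multiplicity at least \<open>k\<close> to \<open>w\<close>.\<close>
    have "pcompose g [:-w, 1:] = g"
    proof (rule poly_eqI_infinite[OF infinite_field])
      fix x
      have "ev3 G (vec3 x y z) = ev3 G (vec3 (x + a * y) y z)"
        using transv_inv_Fq[OF inv, of 0 1 a "vec3 x y z"] ab(1)
        by (simp add: G_def vec3_axis)
      also have "\<dots> = ev3 G (vec3 (x + a * y + b * z) y z)"
        using transv_inv_Fq[OF inv, of 0 2 b "vec3 (x + a * y) y z"] ab(2)
        by (simp add: G_def vec3_axis)
      finally show "poly (pcompose g [:-w, 1:]) x = poly g x"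
        by (simp add: ev3_def g_def poly_pcompose ab(3) ac_simps)
    qed
    then have "g = pcompose ([:0, 1:] ^ k * g') [:-w, 1:]"
      using g by simp
    also have "\<dots> = [:-w, 1:] ^ k * pcompose g' [:-w, 1:]"
      by (simp add: pcompose_mult pcompose_power pcompose_pCons)
    finally show ?thesis
      by simp
  qed
  then have "card ((\<lambda>ab. - ?w ab) ` (Fq \<times> Fq)) * k \<le> degree g"
    using y(2) k finite_Fq by (intro repeated_root_count_le_degree) (auto simp: g_def)
  also have "card ((\<lambda>ab. - ?w ab) ` (Fq \<times> Fq)) = q ^ 2"
    using inj by (simp add: card_image card_cartesian_product card_Fq_eq power2_eq_square)
  also have "degree g \<le> d"
    unfolding g_def G_def using hom by (rule homogeneous3_degree_restriction)
  finally show ?thesis .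
qed

text \<open>Otherwise \<open>F\<close> is X times a unit, which vanishes nowhere. But a transvection
  moves (0,1,0), where \<open>F\<close> vanishes, to (1,1,0), where it does not.\<close>

lemma irreducible_transv_inv_not_varX_dvd:
  fixes F :: "'k tpoly"
  assumes "irreducible F" and "transv_inv q F"
  shows "\<not> varX dvd F"
proof
  assume "varX dvd F"
  then obtain u where u: "F = varX * u"
    by (elim dvdE)
  have "\<not> varX dvd (1 :: 'k tpoly)"
    by (simp add: varX_dvd_iff tcoeff_def)
  then have "u dvd 1"
    using irreducibleD[OF assms(1) u] by blast
  then obtain w where "1 = u * w"
    by (elim dvdE)
  then have "ev3 u v * ev3 w v = 1" for v
    by (metis ev3_ring_hom(2,5))
  then have "ev3 u v \<noteq> 0" for v
    by (metis mult_zero_left zero_neq_one)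
  moreover have "ev3 F (vec3 1 1 0) = ev3 F (vec3 0 1 0)"
    using transv_inv_Fq[OF assms(2), of 0 1 1 "vec3 0 1 0"] Fq_closed(2)
    by (simp add: vec3_axis)
  ultimately show False
    by (simp add: u)
qed

lemma transv_inv_varX_dvd_large_degree:
  fixes G :: "'k tpoly"
  assumes "transv_inv q G" and "homogeneous3 G d" and "q dvd d"
    and "varX dvd G" and "G \<noteq> 0"
  shows "q ^ 3 \<le> d"
proof -
  \<comment> \<open>The part \<open>k \<le> d\<close> ensures that a greatest exponent exists; the
    other part is the degree estimate for it.\<close>
  have bound: "k \<le> d \<and> (k \<ge> 1 \<longrightarrow> q ^ 2 * k \<le> d)" if dvd: "varX ^ k dvd G" for k
  proof (cases "k \<ge> 1")
    case True
    obtain F where F: "G = varX ^ k * F"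
      using dvd by (elim dvdE)
    then have "q ^ 2 * k \<le> d"
      using assms True by (intro line_multiplicity_bound[of k F d]) auto
    moreover have "k \<le> q ^ 2 * k"
      using q_pos by simp
    ultimately show ?thesis
      by linarith
  qed simp
  have "varX ^ 1 dvd G"
    using assms(4) by simp
  then obtain k where k: "varX ^ k dvd G" "\<And>k'. varX ^ k' dvd G \<Longrightarrow> k' \<le> k"
    using Nat.ex_has_greatest_nat[of "\<lambda>k. varX ^ k dvd G" 1 d] bound by blast
  have "k \<ge> 1"
    using k(2)[of 1] assms(4) by simp
  obtain F where F: "G = varX ^ k * F"
    using k(1) by (elim dvdE)
  have "\<not> varX dvd F"
    using k(2)[of "Suc k"] F by (auto simp: mult.assoc mult.left_commute)
  moreover have "homogeneous3 F (d - k)"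
    using assms(2) F by (auto intro: homogeneous3_varX_power_mult)
  ultimately have "q dvd d - k"
    using q_dvd_cofactor_degree[of k F "d - k"] assms(1) F by blast
  moreover have "k \<le> d"
    using bound[OF k(1)] by blast
  ultimately have "q dvd k"
    using assms(3) by (metis dvd_diff_nat diff_diff_cancel)
  then have "q \<le> k"
    using \<open>k \<ge> 1\<close> by (intro dvd_imp_le) auto
  then have "q ^ 2 * q \<le> q ^ 2 * k"
    by simp
  also have "\<dots> \<le> d"
    using bound[OF k(1)] \<open>k \<ge> 1\<close> by blast
  finally show ?thesis
    by (simp add: power3_eq_cube power2_eq_square)
qed

section \<open>Homologies and the passage from SL(3,q) to GL(3,q)\<close>

lemma homology_semi_invariant:
  fixes F :: "'k tpoly"
  assumes hom: "homogeneous3 F d" and "d < q ^ 3" and "\<not> varX dvd F"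
    and SL: "\<forall>M \<in> SL3 q. invariant_under F M"
    and t: "t \<in> Fq" "t \<noteq> 0"
  obtains c where "c \<noteq> 0" and "\<And>v. ev3 F (vec3 (v$0) (v$1) (t * v$2)) = c * ev3 F v"
proof -
  have "F \<noteq> 0"
    using assms(3) by auto
  then have inv: "transv_inv q F"
    using SL by (rule invariant_under_SL3_imp_transv_inv)
  \<comment> \<open>The entry \<open>inverse t\<close> makes the determinant 1 without changing the
    action on X = 0, where \<open>M\<close> agrees with diag(1,1,t).\<close>
  define M :: "'k^3^3" where
    "M = (\<chi> r s. if r = s then (if r = 0 then inverse t else if r = 1 then 1 else t) else 0)"
  have "over_Fq q M"
    using t Fq_closed by (auto simp: over_Fq_iff M_def)
  moreover have "det M = 1"
    using t by (simp add: det_index3 M_def)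
  ultimately have "invariant_under F M"
    using SL by (simp add: SL3_def)
  then obtain c where c: "c \<noteq> 0" "transform3 F M = const3 c * F"
    by (auto simp: invariant_under_def)
  have Mv: "M *v v = vec3 (inverse t * v$0) (v$1) (t * v$2)" for v
    by (simp add: vec3_eq_iff matrix_vector_mult_def M_def sum_index3)
  have diag: "ev3 F (vec3 (inverse t * v$0) (v$1) (t * v$2)) = c * ev3 F v" for v
    using arg_cong[OF c(2), of "\<lambda>H. ev3 H v"] by (simp add: ev3_transform3 Mv)
  define G where "G = pcompose F [:0, [:[:t:]:]:] - const3 c * F"
  have evG: "ev3 G v = ev3 F (vec3 (v$0) (v$1) (t * v$2)) - c * ev3 F v" for v
    by (simp add: G_def ev3_pcompose_linear)
  have tcG: "tcoeff G i j l = (t ^ l - c) * tcoeff F i j l" for i j l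
    by (simp add: G_def tcoeff_def const3_def coeff_pcompose_linear poly_const_pow algebra_simps)
  have homG: "homogeneous3 G d"
    using hom by (auto simp: homogeneous3_def tcG)
  have "transv_inv q G"
    unfolding transv_inv_def
  proof (intro allI impI)
    fix i j :: 3 and a :: 'k and v :: "'k^3"
    assume ij: "i \<noteq> j" and a: "a ^ q = a"
    let ?D = "\<lambda>v :: 'k^3. vec3 (v$0) (v$1) (t * v$2)"
    \<comment> \<open>These are the diagonal entries of \<open>?D\<close>. Conjugation by
      \<open>?D\<close> rescales the transvection parameter to
      \<open>\<delta> i * a / \<delta> j\<close>, still in \<open>Fq\<close>.\<close>
    define \<delta> where "\<delta> = (\<lambda>r :: 3. if r = 2 then t else 1)"
    have "\<delta> i * a / \<delta> j \<in> Fq"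
      using a t Fq_closed by (auto simp: \<delta>_def Fq_def)
    then have "ev3 F (?D v + axis i (\<delta> i * a / \<delta> j * ?D v $ j)) = ev3 F (?D v)"
      using inv ij by (intro transv_inv_Fq) auto
    moreover have "?D (v + axis i (a * v$j)) = ?D v + axis i (\<delta> i * a / \<delta> j * ?D v $ j)"
      using ij t by (cases i rule: index3_exhaust; cases j rule: index3_exhaust)
        (simp_all add: vec3_eq_iff \<delta>_def axis_def algebra_simps)
    ultimately show "ev3 G (v + axis i (a * v$j)) = ev3 G v"
      using transv_invD[OF inv ij a, of v] by (simp add: evG)
  qed
  moreover have "varX dvd G"
  proof -
    \<comment> \<open>Values at Z = 1 suffice: by homogeneity the exponent of Y determines that of Z
      on X = 0.\<close>
    have zero: "ev3 G (vec3 0 y 1) = 0" for y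
      using diag[of "vec3 0 y 1"] by (simp add: evG)
    have "(\<Sum>l\<le>d. monom (tcoeff G 0 (d - l) l) (d - l)) = 0"
      using zero
      by (intro poly_eqI_infinite[OF infinite_field])
        (simp add: homogeneous3_ev3_X0[OF homG] poly_sum poly_monom)
    then have "coeff (\<Sum>l\<le>d. monom (tcoeff G 0 (d - l) l) (d - l)) j = 0" for j
      by simp
    moreover have "coeff (\<Sum>l\<le>d. monom (tcoeff G 0 (d - l) l) (d - l)) j = tcoeff G 0 j l"
      if "j + l = d" for j l
    proof -
      have "coeff (\<Sum>l\<le>d. monom (tcoeff G 0 (d - l) l) (d - l)) j =
          (\<Sum>l'\<le>d. if l' = l then tcoeff G 0 (d - l') l' else 0)"
        unfolding coeff_sum coeff_monom using that by (intro sum.cong) auto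
      then show ?thesis
        using that by auto
    qed
    ultimately have "tcoeff G 0 j l = 0" for j l
      using homG unfolding homogeneous3_def by (metis add_0)
    then show ?thesis
      by (simp add: varX_dvd_iff)
  qed
  moreover have "q dvd d"
    using q_dvd_cofactor_degree[of 0 F d] inv hom assms(3) by simp
  ultimately have "G = 0"
    using transv_inv_varX_dvd_large_degree[of G d] homG assms(2) by force
  then have "ev3 F (vec3 (v$0) (v$1) (t * v$2)) = c * ev3 F v" for v
    using evG[of v] by simp
  then show thesis
    using c(1) that by blast
qed

lemma invariant_under_GL3:
  fixes F :: "'k tpoly"
  assumes hom: "homogeneous3 F d" and "d < q ^ 3" and "irreducible F"
    and SL: "\<forall>M \<in> SL3 q. invariant_under F M" and M: "M \<in> GL3 q"
  shows "invariant_under F M"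
proof -
  define t where "t = det M"
  have MFq: "over_Fq q M" and t: "t \<in> Fq" "t \<noteq> 0"
    using M det_in_Fq by (auto simp: GL3_def t_def)
  have "F \<noteq> 0"
    using assms(3) by auto
  then have "\<not> varX dvd F"
    using irreducible_transv_inv_not_varX_dvd invariant_under_SL3_imp_transv_inv assms(3) SL by blast
  then obtain c where c: "c \<noteq> 0" "\<And>v. ev3 F (vec3 (v$0) (v$1) (t * v$2)) = c * ev3 F v"
    using homology_semi_invariant[OF hom assms(2) _ SL t] by blast
  \<comment> \<open>Dividing the last column by \<open>t = det M\<close> gives determinant 1 and the
    factorization of \<open>M\<close> as \<open>N\<close> times diag(1,1,t); the two scalar factors
    of \<open>F\<close> then multiply.\<close>
  define N :: "'k^3^3" where "N = (\<chi> r s. if s = 2 then M$r$s / t else M$r$s)"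
  have "over_Fq q N"
    using MFq t Fq_closed by (auto simp: over_Fq_iff N_def)
  moreover have "det N = det M / t"
    using t by (simp add: det_index3 N_def field_simps)
  ultimately have "N \<in> SL3 q"
    using t by (simp add: SL3_def t_def)
  then obtain c' where c': "c' \<noteq> 0" "transform3 F N = const3 c' * F"
    using SL by (auto simp: invariant_under_def)
  have "M *v v = N *v vec3 (v$0) (v$1) (t * v$2)" for v
    using t by (simp add: vec3_eq_iff matrix_vector_mult_def N_def sum_index3)
  then have "ev3 (transform3 F M) v = ev3 (transform3 F N) (vec3 (v$0) (v$1) (t * v$2))" for v
    by (simp add: ev3_transform3)
  then have "ev3 (transform3 F M) v = ev3 (const3 (c' * c) * F) v" for v
    by (simp add: c(2) c'(2))
  then have "transform3 F M = const3 (c' * c) * F"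
    by (rule ev3_eqI[OF infinite_field])
  then show ?thesis
    unfolding invariant_under_def using c(1) c'(1) by (intro exI[of _ "c' * c"]) simp
qed

end

theorem mainTheorem8:
  fixes p q d :: nat and F :: "'k::field tpoly"
  assumes "alg_closure_of_prime_field p TYPE('k)"
    and "\<exists>n\<ge>1. q = p ^ n"
    and "plane_curve F d"
    and "irreducible F"
    and "d < q ^ 3 - q"
    and "\<forall>M \<in> SL3 q. invariant_under F M"
  shows "\<forall>M \<in> GL3 q. invariant_under F M"
proof -
  obtain n where "q = p ^ n" "n \<ge> 1"
    using assms(2) by blast
  then interpret alg_closure_of_Fq p n q "TYPE('k)"
    using assms(1) by unfold_locales
  show ?thesis
    using invariant_under_GL3[of F d] assms(3-6) by (auto simp: plane_curve_def)
qed

end
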